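(* Let $n\ge 4$ and $q=e^{\pi i/n}$. Let $\mathcal{U}$ denote the weights on $\mathcal{A}^{(n)}$ defined from the cells $$W_{\triangle(k,m)}=\frac{\sqrt{[k+1][k+2][m+1][m+2][k+m+2][k+m+3]}}{[2]},\qquad W_{\nabla(k,m)}=\frac{\sqrt{[k+1][k+2][m+1][m+2][k+m+3][k+m+4]}}{[2]}.$$ Then these weights are identical to Wenzl's weights: for every vertex $\lambda=(\lambda_1,\lambda_2)$ of $\mathcal{A}^{(n)}$, all $j,l\in\{1,2,3\}$ and $k\in\{j,l\}$ such that $\lambda+e_j$, $\lambda+e_k$ and $\lambda+e_j+e_l$ are vertices of $\mathcal{A}^{(n)}$, the weight $\mathcal{U}^{\rho_1,\rho_2}_{\rho_3,\rho_4}$ with $(\rho_1,\rho_2)$ the path $\lambda\to\lambda+e_k\to\lambda+e_j+e_l$ and $(\rho_3,\rho_4)$ the path $\lambda\to\lambda+e_j\to\lambda+e_j+e_l$ equals $$(1-\delta_{jl})\,\frac{\sqrt{s_{jl}(\lambda'+e_j)\,s_{jl}(\lambda'+e_k)}}{|s_{jl}(\lambda')|}$$ (interpreted as $0$ when $j=l$).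
   Context: $[m]=(q^m-q^{-m})/(q-q^{-1})$. The graph $\mathcal{A}^{(n)}$ has vertices $(\lambda_1,\lambda_2)$, $\lambda_1,\lambda_2\ge 0$ integers with $\lambda_1+\lambda_2\le n-3$, and directed edges $(\lambda_1,\lambda_2)\to(\lambda_1+1,\lambda_2)$, $(\lambda_1-1,\lambda_2+1)$, $(\lambda_1,\lambda_2-1)$ whenever the target is a vertex. Let $\phi_{(\lambda_1,\lambda_2)}=[\lambda_1+1][\lambda_2+1][\lambda_1+\lambda_2+2]/[2]$. $\triangle(k,m)$ is the triangle $(k,m)\to(k+1,m)\to(k,m+1)\to(k,m)$ and $\nabla(k,m)$ is the triangle $(k+1,m)\to(k,m+1)\to(k+1,m+1)\to(k+1,m)$; triangles (closed paths of length 3) are considered up to cyclic rotation, and these are all the triangles of $\mathcal{A}^{(n)}$. Weights from cells: for paths $(\rho_1,\rho_2)$, $l\xrightarrow{\rho_1}i\xrightarrow{\rho_2}j$, and $(\rho_3,\rho_4)$, $l\xrightarrow{\rho_3}k\xrightarrow{\rho_4}j$, with the same endpoints, $$\mathcal{U}^{\rho_1,\rho_2}_{\rho_3,\rho_4}=\sum_{\nu}\phi_l^{-1}\phi_j^{-1}W(\triangle_{j,l,k}^{(\nu,\rho_3,\rho_4)})\overline{W(\triangle_{j,l,i}^{(\nu,\rho_1,\rho_2)})},$$ summed over the edges $\nu$ from $j$ to $l$ (an empty sum is $0$). Wenzl's weights: $e_1,e_2,e_3$ denote the vectors from $(\lambda_1,\lambda_2)$ to $(\lambda_1+1,\lambda_2)$,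 $(\lambda_1-1,\lambda_2+1)$, $(\lambda_1,\lambda_2-1)$ respectively (so $e_1+e_2+e_3=0$), with inner product determined by $e_j\cdot e_k=\delta_{jk}-1/3$. A point $(a,b)$ is identified with the vector $a e_1-b e_3$. For $\lambda=(\lambda_1,\lambda_2)$, $\lambda'=(\lambda_1+1,\lambda_2+1)$, i.e. the vector $(\lambda_1+1)e_1-(\lambda_2+1)e_3$, and $s_{jl}(\mu)=\sin\big((\pi/n)(e_j-e_l)\cdot\mu\big)$. *)

theory Defs
  imports "HOL-Analysis.Analysis" "Graph_Theory.Digraph"
begin

definition qint :: "complex \<Rightarrow> int \<Rightarrow> complex" where
  "qint q m = (q powi m - q powi (- m)) / (q - q powi (- 1))"

text \<open>Coordinates \<open>(\<lambda>\<^sub>1, \<lambda>\<^sub>2)\<close> of the vectors \<open>e\<^sub>1, e\<^sub>2, e\<^sub>3\<close>; only the indices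
  1, 2, 3 are meaningful.\<close>

definition step :: "nat \<Rightarrow> int \<times> int" where
  "step j = (if j = 1 then (1, 0) else if j = 2 then (- 1, 1) else (0, - 1))"

type_synonym vert = "int \<times> int"
type_synonym edge = "vert \<times> vert"

definition A_verts :: "nat \<Rightarrow> vert set" where
  "A_verts n = {(a, b). 0 \<le> a \<and> 0 \<le> b \<and> a + b \<le> int n - 3}"

text \<open>The graph has no parallel edges, so an edge is the pair of its source and its range.\<close>

definition A_graph :: "nat \<Rightarrow> (vert, edge) pre_digraph" where
  "A_graph n = \<lparr> verts = A_verts n,
     arcs = {(v, w). v \<in> A_verts n \<and> w \<in> A_verts n \<and> (\<exists>j\<in>{1, 2, 3}. w = v + step j)},
     tail = fst, head = snd \<rparr>"

definition phi :: "complex \<Rightarrow> vert \<Rightarrow> complex" where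
  "phi q = (\<lambda>(a, b). qint q (a + 1) * qint q (b + 1) * qint q (a + b + 2) / qint q 2)"

text \<open>A closed path of length 3 up to cyclic rotation is represented by the set of its three
  rotations. A system of cells is a function on these classes.\<close>

definition cyc :: "'e \<Rightarrow> 'e \<Rightarrow> 'e \<Rightarrow> ('e \<times> 'e \<times> 'e) set" where
  "cyc a b c = {(a, b, c), (b, c, a), (c, a, b)}"

definition triangles :: "('v, 'e) pre_digraph \<Rightarrow> ('e \<times> 'e \<times> 'e) set set" where
  "triangles G = {cyc a b c | a b c. {a, b, c} \<subseteq> arcs G \<and>
     head G a = tail G b \<and> head G b = tail G c \<and> head G c = tail G a}"

definition up_tri :: "int \<Rightarrow> int \<Rightarrow> (edge \<times> edge \<times> edge) set" where
  "up_tri k m = cyc ((k, m), (k + 1, m)) ((k + 1, m), (k, m + 1)) ((k, m + 1), (k, m))"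

definition down_tri :: "int \<Rightarrow> int \<Rightarrow> (edge \<times> edge \<times> edge) set" where
  "down_tri k m =
     cyc ((k + 1, m), (k, m + 1)) ((k, m + 1), (k + 1, m + 1)) ((k + 1, m + 1), (k + 1, m))"

text \<open>The first path \<open>(\<rho>\<^sub>1, \<rho>\<^sub>2)\<close> is the upper index of the weight and the second path
  \<open>(\<rho>\<^sub>3, \<rho>\<^sub>4)\<close> the lower one. The definition is meant for composable paths with common
  endpoints; these are read off from the second path.\<close>

definition cell_weight ::
  "('v, 'e) pre_digraph \<Rightarrow> ('v \<Rightarrow> complex) \<Rightarrow> (('e \<times> 'e \<times> 'e) set \<Rightarrow> complex) \<Rightarrow>
   'e \<times> 'e \<Rightarrow> 'e \<times> 'e \<Rightarrow> complex" where
  "cell_weight G \<phi> W = (\<lambda>(\<rho>1, \<rho>2) (\<rho>3, \<rho>4).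
     (\<Sum>\<nu> \<in> {\<nu> \<in> arcs G. tail G \<nu> = head G \<rho>4 \<and> head G \<nu> = tail G \<rho>3}.
        inverse (\<phi> (tail G \<rho>3)) * inverse (\<phi> (head G \<rho>4)) *
        W (cyc \<nu> \<rho>3 \<rho>4) * cnj (W (cyc \<nu> \<rho>1 \<rho>2))))"

text \<open>In what follows \<open>e\<close> is a realisation of \<open>e\<^sub>1, e\<^sub>2, e\<^sub>3\<close> in a real inner product space.\<close>

definition lattice_vec :: "(nat \<Rightarrow> 'v::real_inner) \<Rightarrow> vert \<Rightarrow> 'v" where
  "lattice_vec e = (\<lambda>(a, b). of_int a *\<^sub>R e 1 - of_int b *\<^sub>R e 3)"

definition s_fun :: "nat \<Rightarrow> (nat \<Rightarrow> 'v::real_inner) \<Rightarrow> nat \<Rightarrow> nat \<Rightarrow> 'v \<Rightarrow> real" where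
  "s_fun n e j l \<mu> = sin (pi / real n * ((e j - e l) \<bullet> \<mu>))"

text \<open>For \<open>j = l\<close> the value is 0.\<close>

definition wenzl_weight ::
  "nat \<Rightarrow> (nat \<Rightarrow> 'v::real_inner) \<Rightarrow> vert \<Rightarrow> nat \<Rightarrow> nat \<Rightarrow> nat \<Rightarrow> real" where
  "wenzl_weight n e v j l k = (let v' = lattice_vec e (v + (1, 1)) in
     (1 - of_bool (j = l)) *
     (sqrt (s_fun n e j l (v' + e j) * s_fun n e j l (v' + e k)) / \<bar>s_fun n e j l v'\<bar>))"

text \<open>Vectors with the required inner products exist.\<close>

lemma ex_frame:
  "\<exists>e :: nat \<Rightarrow> real ^ 3. \<forall>i\<in>{1, 2, 3}. \<forall>j\<in>{1, 2, 3}. e i \<bullet> e j = of_bool (i = j) - 1 / 3"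
  by (rule exI [where x = "\<lambda>i. \<chi> r. of_bool (r = of_nat i) - 1 / 3"])
     (simp add: inner_vec_def sum_3)

end

theory Submission
  imports Defs
begin

text \<open>
  Put \<open>A = \<lambda>\<^sub>1 + 1\<close>, \<open>B = \<lambda>\<^sub>2 + 1\<close>. Since \<open>q\<close> lies on the unit circle, \<open>[m]\<close> is the real number
  \<open>sin (\<pi> m / n) / sin (\<pi> / n)\<close>, and it is positive for \<open>0 < m < n\<close>. All sines in Wenzl's weights
  are therefore quantum integers up to the common factor \<open>sin (\<pi> / n)\<close>: the relations between the
  \<open>e\<^sub>j\<close> give \<open>(e\<^sub>j - e\<^sub>l) \<cdot> \<lambda>' = c\<^sub>j - c\<^sub>l =: d\<close> with \<open>(c\<^sub>1, c\<^sub>2, c\<^sub>3) = (A, 0, - B)\<close>, and moving from \<open>\<lambda>'\<close>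
  to \<open>\<lambda>' + e\<^sub>j\<close> or \<open>\<lambda>' + e\<^sub>l\<close> changes \<open>d\<close> by \<open>+ 1\<close> or \<open>- 1\<close>.

  The core is one formula for the six kinds of triangles through \<open>\<lambda>\<close> (lemma \<open>cell_along_path\<close>). For
  \<open>j \<noteq> l\<close>, a path \<open>\<lambda> \<rightarrow> \<lambda> + e\<^sub>j \<rightarrow> \<lambda> + e\<^sub>j + e\<^sub>l = \<mu>\<close> closes up in exactly one way, because
  \<open>e\<^sub>1 + e\<^sub>2 + e\<^sub>3 = 0\<close>, and the square of the resulting cell is \<open>\<phi>\<^sub>\<lambda> \<phi>\<^sub>\<mu> [d + 1] / [d]\<close>. For example,
  \<open>j = 1\<close>, \<open>l = 2\<close> gives the upward triangle at \<open>\<lambda>\<close>, whose squared cell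
  \<open>[A] [A + 1] [B] [B + 1] [A + B] [A + B + 1] / [2]\<^sup>2\<close> is
  \<open>\<phi>\<^sub>\<lambda> \<phi>\<^sub>\<mu> = [A]\<^sup>2 [B] [B + 1] [A + B] [A + B + 1] / [2]\<^sup>2\<close> times \<open>[A + 1] / [A]\<close>.
  Exchanging \<open>j\<close> and \<open>l\<close> negates \<open>d\<close> and fixes \<open>\<mu>\<close>, so the other path from \<open>\<lambda>\<close> to \<open>\<mu>\<close> has squared cell
  \<open>\<phi>\<^sub>\<lambda> \<phi>\<^sub>\<mu> [d - 1] / [d]\<close>. In the product of two cells divided by \<open>\<phi>\<^sub>\<lambda> \<phi>\<^sub>\<mu>\<close> the weights \<open>\<phi>\<close> cancel, and
  what remains is Wenzl's expression.

  For \<open>j = l\<close> no edge leads from \<open>\<lambda> + 2 e\<^sub>j\<close> back to \<open>\<lambda>\<close>, so both sides vanish.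
\<close>

section \<open>Quantum integers at a root of unity\<close>

definition real_qint :: "nat \<Rightarrow> int \<Rightarrow> real" where
  "real_qint n m = sin (pi / real n * real_of_int m) / sin (pi / real n)"

lemma qint_root_of_unity:
  assumes "q = exp (complex_of_real pi * \<i> / of_nat n)"
  shows "qint q m = complex_of_real (real_qint n m)"
proof -
  have q: "q = cis (pi / real n)"
    using assms by (simp add: cis_conv_exp mult.commute)
  have powi: "q powi m = cis (pi / real n * real_of_int m)" for m
    by (simp add: q cis_power_int mult.commute)
  have "cis x - cis (- x) = 2 * \<i> * complex_of_real (sin x)" for x
    by (simp add: complex_eq_iff)
  then have diff: "q powi m - q powi (- m) =
      2 * \<i> * complex_of_real (sin (pi / real n * real_of_int m))" for m
    unfolding powi by simp
  show ?thesis
    unfolding qint_def real_qint_def using diff[of m] diff[of 1] by simp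
qed

lemma real_qint_pos:
  assumes "0 < m" "m < int n"
  shows "real_qint n m > 0"
proof -
  have sin_pos: "0 < sin (pi / real n * real_of_int k)" if "0 < k" "k < int n" for k
  proof (rule sin_gt_zero)
    have "real_of_int k < real n"
      using that by linarith
    then show "pi / real n * real_of_int k < pi"
      using that by (simp add: field_simps)
    show "0 < pi / real n * real_of_int k"
      using that by simp
  qed
  show ?thesis
    unfolding real_qint_def using sin_pos[of m] sin_pos[of 1] assms by simp
qed

lemma real_qint_uminus: "real_qint n (- m) = - real_qint n m"
  by (simp add: real_qint_def)

definition real_phi :: "nat \<Rightarrow> vert \<Rightarrow> real" where
  "real_phi n = (\<lambda>(a, b). real_qint n (a + 1) * real_qint n (b + 1) * real_qint n (a + b + 2) /
     real_qint n 2)"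

lemma phi_root_of_unity:
  assumes "q = exp (complex_of_real pi * \<i> / of_nat n)"
  shows "phi q v = complex_of_real (real_phi n v)"
  by (cases v) (simp add: phi_def real_phi_def qint_root_of_unity[OF assms])

lemma real_phi_pos:
  assumes "n \<ge> 4" "v \<in> A_verts n"
  shows "real_phi n v > 0"
  using assms by (cases v)
    (auto simp: real_phi_def A_verts_def intro!: divide_pos_pos mult_pos_pos real_qint_pos)

section \<open>Gaps of the shifted weight\<close>

text \<open>This is the inner product \<open>(e\<^sub>j - e\<^sub>l) \<cdot> \<lambda>'\<close>, as lemma \<open>inner_lattice_vec\<close> shows.\<close>

definition gap :: "vert \<Rightarrow> nat \<Rightarrow> nat \<Rightarrow> int" where
  "gap v j l = (let c = (\<lambda>i. if i = 1 then fst v + 1 else if i = 3 then - (snd v + 1) else 0)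
     in c j - c l)"

lemma gap_swap: "gap v l j = - gap v j l"
  by (simp add: gap_def Let_def)

lemma inner_lattice_vec:
  fixes e :: "nat \<Rightarrow> 'v::real_inner"
  assumes e: "\<And>i j. i \<in> {1, 2, 3} \<Longrightarrow> j \<in> {1, 2, 3} \<Longrightarrow> e i \<bullet> e j = of_bool (i = j) - 1 / 3"
    and "j \<in> {1, 2, 3}" "l \<in> {1, 2, 3}"
  shows "(e j - e l) \<bullet> lattice_vec e (v + (1, 1)) = real_of_int (gap v j l)"
proof (cases v)
  case (Pair a b)
  have "(e j - e l) \<bullet> lattice_vec e (v + (1, 1)) =
      (real_of_int a + 1) * (e j \<bullet> e 1 - e l \<bullet> e 1) -
      (real_of_int b + 1) * (e j \<bullet> e 3 - e l \<bullet> e 3)"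
    by (simp add: Pair lattice_vec_def inner_diff_left inner_diff_right)
  also have "\<dots> = real_of_int (gap v j l)"
    using assms(2,3) by (auto simp: Pair gap_def e)
  finally show ?thesis .
qed

lemma s_fun_eq_real_qint:
  fixes e :: "nat \<Rightarrow> 'v::real_inner"
  assumes "n \<ge> 4"
    and e: "\<And>i j. i \<in> {1, 2, 3} \<Longrightarrow> j \<in> {1, 2, 3} \<Longrightarrow> e i \<bullet> e j = of_bool (i = j) - 1 / 3"
    and jl: "j \<in> {1, 2, 3}" "l \<in> {1, 2, 3}"
  shows "s_fun n e j l (lattice_vec e (v + (1, 1))) = sin (pi / real n) * real_qint n (gap v j l)"
    and "k \<in> {1, 2, 3} \<Longrightarrow> s_fun n e j l (lattice_vec e (v + (1, 1)) + e k) =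
      sin (pi / real n) * real_qint n (gap v j l + of_bool (j = k) - of_bool (l = k))"
proof -
  have "sin (pi / real n) > 0"
    using \<open>n \<ge> 4\<close> by (intro sin_gt_zero) (auto simp: field_simps)
  then have sin_eq: "sin (pi / real n * real_of_int m) = sin (pi / real n) * real_qint n m" for m
    by (simp add: real_qint_def)
  show "s_fun n e j l (lattice_vec e (v + (1, 1))) = sin (pi / real n) * real_qint n (gap v j l)"
    by (simp only: s_fun_def inner_lattice_vec[OF e jl] sin_eq)
  assume k: "k \<in> {1, 2, 3}"
  have "(e j - e l) \<bullet> (lattice_vec e (v + (1, 1)) + e k) =
      real_of_int (gap v j l + of_bool (j = k) - of_bool (l = k))"
    by (simp only: inner_add_right inner_lattice_vec[OF e jl])
       (simp only: inner_diff_left e[OF jl(1) k] e[OF jl(2) k], simp)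
  then show "s_fun n e j l (lattice_vec e (v + (1, 1)) + e k) =
      sin (pi / real n) * real_qint n (gap v j l + of_bool (j = k) - of_bool (l = k))"
    by (simp only: s_fun_def sin_eq)
qed

section \<open>The cell of a triangle through a given path\<close>

lemma cyc_rotate: "cyc a b c = cyc b c a" "cyc a b c = cyc c a b"
  by (auto simp: cyc_def)

text \<open>Positivity of all quantum integers in the radicand lets the complex square root be
  replaced by the real one.\<close>

lemma csqrt_qint_prod:
  assumes q: "q = exp (complex_of_real pi * \<i> / of_nat n)"
    and n: "n \<ge> 4"
    and ms: "\<forall>m \<in> {m1, m2, m3, m4, m5, m6}. 0 < m \<and> m < int n"
  shows "csqrt (qint q m1 * qint q m2 * qint q m3 * qint q m4 * qint q m5 * qint q m6) / qint q 2 =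
    complex_of_real (sqrt (real_qint n m1 * real_qint n m2 * real_qint n m3 * real_qint n m4 *
      real_qint n m5 * real_qint n m6 / (real_qint n 2)\<^sup>2))"
proof -
  let ?P = "real_qint n m1 * real_qint n m2 * real_qint n m3 * real_qint n m4 *
      real_qint n m5 * real_qint n m6"
  have "real_qint n m > 0" if "m \<in> {m1, m2, m3, m4, m5, m6}" for m
    using that ms by (intro real_qint_pos) auto
  then have "?P \<ge> 0"
    by (intro mult_nonneg_nonneg) (auto intro: less_imp_le)
  moreover have "real_qint n 2 > 0"
    using n by (intro real_qint_pos) auto
  ultimately show ?thesis
    unfolding qint_root_of_unity[OF q] of_real_mult[symmetric]
    by (simp add: real_sqrt_divide flip: of_real_sqrt)
qed

lemma closed_path_in_triangles:
  assumes "j \<in> {1, 2, 3}" "l \<in> {1, 2, 3}" "j \<noteq> l"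
    and "v \<in> A_verts n" "v + step j \<in> A_verts n" "v + step j + step l \<in> A_verts n"
  shows "(v + step j + step l, v) \<in> arcs (A_graph n)"
    and "cyc (v + step j + step l, v) (v, v + step j) (v + step j, v + step j + step l)
      \<in> triangles (A_graph n)"
proof -
  have arcI: "(x, x + step i) \<in> arcs (A_graph n)"
    if "x \<in> A_verts n" "x + step i \<in> A_verts n" "i \<in> {1, 2, 3}" for x i
    using that unfolding A_graph_def by auto
  \<comment> \<open>The closing edge goes in the third direction, \<open>6 - j - l\<close>.\<close>
  have closing: "v + step j + step l + step (6 - j - l) = v" "6 - j - l \<in> {1, 2, 3}"
    using assms(1-3) by (elim insertE emptyE; simp add: step_def prod_eq_iff)+
  show arc: "(v + step j + step l, v) \<in> arcs (A_graph n)"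
    using arcI[of "v + step j + step l" "6 - j - l"] assms(4,6) unfolding closing(1)
    by (simp only: closing(2))
  have "{(v + step j + step l, v), (v, v + step j), (v + step j, v + step j + step l)}
      \<subseteq> arcs (A_graph n)"
    using arc arcI[of v j] arcI[of "v + step j" l] assms by simp
  then show "cyc (v + step j + step l, v) (v, v + step j) (v + step j, v + step j + step l)
      \<in> triangles (A_graph n)"
    unfolding triangles_def by (intro CollectI exI conjI) (auto simp: A_graph_def)
qed

text \<open>In each of the six cases the triangle is upward or downward according to whether
  \<open>(j, l)\<close> is a cyclic shift of \<open>(1, 2)\<close> or of \<open>(2, 1)\<close>. With \<open>\<mu> = \<lambda> + e\<^sub>j + e\<^sub>l\<close> and \<open>d\<close> the gap, the
  numerator of \<open>\<phi>\<^sub>\<lambda> \<phi>\<^sub>\<mu>\<close> contains \<open>[\<bar>d\<bar>]\<close> twice and four of the other factors under the square root;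
  the ratio \<open>[d + 1] / [d]\<close> exchanges one copy of \<open>[\<bar>d\<bar>]\<close> for the missing factor, which is
  \<open>[d + 1]\<close> if \<open>d > 0\<close> and \<open>[\<bar>d\<bar> - 1]\<close> if \<open>d < 0\<close>.\<close>

lemma cell_along_path:
  fixes W :: "(edge \<times> edge \<times> edge) set \<Rightarrow> complex"
  assumes n: "n \<ge> 4"
    and q: "q = exp (complex_of_real pi * \<i> / of_nat n)"
    and W_up: "\<And>k m. up_tri k m \<in> triangles (A_graph n) \<Longrightarrow>
      W (up_tri k m) =
        csqrt (qint q (k + 1) * qint q (k + 2) * qint q (m + 1) * qint q (m + 2) *
               qint q (k + m + 2) * qint q (k + m + 3)) / qint q 2"
    and W_down: "\<And>k m. down_tri k m \<in> triangles (A_graph n) \<Longrightarrow>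
      W (down_tri k m) =
        csqrt (qint q (k + 1) * qint q (k + 2) * qint q (m + 1) * qint q (m + 2) *
               qint q (k + m + 3) * qint q (k + m + 4)) / qint q 2"
    and jl: "j \<in> {1, 2, 3}" "l \<in> {1, 2, 3}" "j \<noteq> l"
    and verts: "v \<in> A_verts n" "v + step j \<in> A_verts n" "v + step j + step l \<in> A_verts n"
  shows "W (cyc (v + step j + step l, v) (v, v + step j) (v + step j, v + step j + step l)) =
    complex_of_real (sqrt (real_phi n v * real_phi n (v + step j + step l) *
      (real_qint n (gap v j l + 1) / real_qint n (gap v j l))))"
proof -
  obtain a b where v: "v = (a, b)"
    by (cases v)
  let ?tri = "cyc (v + step j + step l, v) (v, v + step j) (v + step j, v + step j + step l)"
  let ?R = "real_phi n v * real_phi n (v + step j + step l) *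
      (real_qint n (gap v j l + 1) / real_qint n (gap v j l))"
  have tri: "?tri \<in> triangles (A_graph n)"
    using closed_path_in_triangles jl verts by blast
  have nz: "real_qint n m \<noteq> 0" if "m \<in> {2, a + 1, b + 1, a + b + 2}" for m
    using that verts(1) n real_qint_pos[of m n] by (auto simp: v A_verts_def)
  have up: "W ?tri = complex_of_real (sqrt ?R)"
    if eq: "?tri = up_tri k m" and km: "0 \<le> k" "0 \<le> m" "k + m + 3 < int n"
      and R: "real_qint n (k + 1) * real_qint n (k + 2) * real_qint n (m + 1) * real_qint n (m + 2) *
        real_qint n (k + m + 2) * real_qint n (k + m + 3) / (real_qint n 2)\<^sup>2 = ?R" for k m
    using W_up[of k m] tri
      csqrt_qint_prod[OF q n, of "k + 1" "k + 2" "m + 1" "m + 2" "k + m + 2" "k + m + 3"] km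
    unfolding eq R by simp
  have down: "W ?tri = complex_of_real (sqrt ?R)"
    if eq: "?tri = down_tri k m" and km: "0 \<le> k" "0 \<le> m" "k + m + 4 < int n"
      and R: "real_qint n (k + 1) * real_qint n (k + 2) * real_qint n (m + 1) * real_qint n (m + 2) *
        real_qint n (k + m + 3) * real_qint n (k + m + 4) / (real_qint n 2)\<^sup>2 = ?R" for k m
    using W_down[of k m] tri
      csqrt_qint_prod[OF q n, of "k + 1" "k + 2" "m + 1" "m + 2" "k + m + 3" "k + m + 4"] km
    unfolding eq R by simp
  have neg: "real_qint n (- x) = - real_qint n x" "real_qint n (- x - y) = - real_qint n (x + y)"
    "real_qint n (- x - y - z) = - real_qint n (x + y + z)" for x y z
    using real_qint_uminus[of n x] real_qint_uminus[of n "x + y"] real_qint_uminus[of n "x + y + z"]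
    by simp_all
  note simps = v step_def gap_def real_phi_def neg
  from jl consider "j = 1" "l = 2" | "j = 2" "l = 3" | "j = 3" "l = 1"
    | "j = 2" "l = 1" | "j = 3" "l = 2" | "j = 1" "l = 3"
    by auto
  then show ?thesis
  proof cases
    case 1
    note simps = simps this
    show ?thesis
    proof (rule up[of a b], goal_cases)
      case 1
      show ?case
        by (simp add: simps up_tri_def down_tri_def cyc_rotate)
    next
      case 5
      show ?case
        using nz by (simp add: simps) (simp add: field_simps power2_eq_square)
    qed (use verts in \<open>auto simp: simps A_verts_def\<close>)
  next
    case 2
    note simps = simps this
    show ?thesis
    proof (rule up[of "a - 1" b], goal_cases)
      case 1
      show ?case
        by (simp add: simps up_tri_def down_tri_def cyc_rotate)
    next
      case 5
      show ?case
        using nz by (simp add: simps) (simp add: field_simps power2_eq_square)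
    qed (use verts in \<open>auto simp: simps A_verts_def\<close>)
  next
    case 3
    note simps = simps this
    show ?thesis
    proof (rule up[of a "b - 1"], goal_cases)
      case 1
      show ?case
        by (simp add: simps up_tri_def down_tri_def cyc_rotate)
    next
      case 5
      show ?case
        using nz by (simp add: simps) (simp add: field_simps power2_eq_square)
    qed (use verts in \<open>auto simp: simps A_verts_def\<close>)
  next
    case 4
    note simps = simps this
    show ?thesis
    proof (rule down[of "a - 1" b], goal_cases)
      case 1
      show ?case
        by (simp add: simps up_tri_def down_tri_def cyc_rotate)
    next
      case 5
      show ?case
        using nz by (simp add: simps) (simp add: field_simps power2_eq_square)
    qed (use verts in \<open>auto simp: simps A_verts_def\<close>)
  next
    case 5
    note simps = simps this
    show ?thesis
    proof (rule down[of "a - 1" "b - 1"], goal_cases)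
      case 1
      show ?case
        by (simp add: simps up_tri_def down_tri_def cyc_rotate)
    next
      case 5
      show ?case
        using nz by (simp add: simps) (simp add: field_simps power2_eq_square)
    qed (use verts in \<open>auto simp: simps A_verts_def\<close>)
  next
    case 6
    note simps = simps this
    show ?thesis
    proof (rule down[of a "b - 1"], goal_cases)
      case 1
      show ?case
        by (simp add: simps up_tri_def down_tri_def cyc_rotate)
    next
      case 5
      show ?case
        using nz by (simp add: simps) (simp add: field_simps power2_eq_square)
    qed (use verts in \<open>auto simp: simps A_verts_def\<close>)
  qed
qed

section \<open>Comparison with Wenzl's weights\<close>

lemma closing_edges:
  assumes "j \<in> {1, 2, 3}" "l \<in> {1, 2, 3}"
    and "v \<in> A_verts n" "v + step j \<in> A_verts n" "v + step j + step l \<in> A_verts n"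
  shows "{\<nu> \<in> arcs (A_graph n). tail (A_graph n) \<nu> = v + step j + step l \<and> head (A_graph n) \<nu> = v} =
    (if j = l then {} else {(v + step j + step l, v)})"
proof (cases "j = l")
  case True
  \<comment> \<open>The negative of twice a step is not a step.\<close>
  then have "v \<noteq> v + step j + step l + step i" for i
    by (auto simp: step_def prod_eq_iff)
  then show ?thesis
    using True by (auto simp: A_graph_def)
next
  case False
  then show ?thesis
    using closed_path_in_triangles(1)[OF assms(1,2) False assms(3-5)] by (auto simp: A_graph_def)
qed

theorem lemma5p2:
  fixes n :: nat and q :: complex and e :: "nat \<Rightarrow> 'v::real_inner"
    and W :: "(edge \<times> edge \<times> edge) set \<Rightarrow> complex"
  assumes n: "n \<ge> 4"
    and q: "q = exp (complex_of_real pi * \<i> / of_nat n)"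
    and W_up: "\<And>k m. up_tri k m \<in> triangles (A_graph n) \<Longrightarrow>
      W (up_tri k m) =
        csqrt (qint q (k + 1) * qint q (k + 2) * qint q (m + 1) * qint q (m + 2) *
               qint q (k + m + 2) * qint q (k + m + 3)) / qint q 2"
    and W_down: "\<And>k m. down_tri k m \<in> triangles (A_graph n) \<Longrightarrow>
      W (down_tri k m) =
        csqrt (qint q (k + 1) * qint q (k + 2) * qint q (m + 1) * qint q (m + 2) *
               qint q (k + m + 3) * qint q (k + m + 4)) / qint q 2"
    and e: "\<And>i j. i \<in> {1, 2, 3} \<Longrightarrow> j \<in> {1, 2, 3} \<Longrightarrow> e i \<bullet> e j = of_bool (i = j) - 1 / 3"
  shows "\<forall>v \<in> verts (A_graph n). \<forall>j \<in> {1, 2, 3}. \<forall>l \<in> {1, 2, 3}. \<forall>k \<in> {j, l}.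
    v + step j \<in> verts (A_graph n) \<longrightarrow> v + step k \<in> verts (A_graph n) \<longrightarrow>
    v + step j + step l \<in> verts (A_graph n) \<longrightarrow>
      cell_weight (A_graph n) (phi q) W
        ((v, v + step k), (v + step k, v + step j + step l))
        ((v, v + step j), (v + step j, v + step j + step l))
      = complex_of_real (wenzl_weight n e v j l k)"
proof (intro ballI impI)
  fix v j l k
  assume "v \<in> verts (A_graph n)" and j: "j \<in> {1, 2, 3}" and l: "l \<in> {1, 2, 3}" and k: "k \<in> {j, l}"
    and "v + step j \<in> verts (A_graph n)" "v + step k \<in> verts (A_graph n)"
      "v + step j + step l \<in> verts (A_graph n)"
  then have vs: "v \<in> A_verts n" "v + step j \<in> A_verts n" "v + step k \<in> A_verts n"
    and w: "v + step j + step l \<in> A_verts n"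
    by (simp_all add: A_graph_def)
  let ?w = "v + step j + step l"
  have tail_head: "tail (A_graph n) = fst" "head (A_graph n) = snd"
    by (simp_all add: A_graph_def)
  note edges = closing_edges[OF j l vs(1,2) w, unfolded tail_head]
  show "cell_weight (A_graph n) (phi q) W ((v, v + step k), (v + step k, ?w))
      ((v, v + step j), (v + step j, ?w)) = complex_of_real (wenzl_weight n e v j l k)"
  proof (cases "j = l")
    case True
    then show ?thesis
      unfolding cell_weight_def tail_head prod.case fst_conv snd_conv edges
      by (simp add: wenzl_weight_def)
  next
    case False
    let ?d = "gap v j l" and ?P = "real_phi n v * real_phi n ?w"
    \<comment> \<open>The gap after a step in direction \<open>k\<close>: here \<open>e\<^sub>j - e\<^sub>l\<close> has inner product \<open>\<plusminus> 1\<close> with \<open>e\<^sub>k\<close>.\<close>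
    let ?dk = "?d + of_bool (j = k) - of_bool (l = k)"
    let ?s = "sin (pi / real n)"
    note cell = cell_along_path[OF n q W_up W_down]
    have cell_j: "W (cyc (?w, v) (v, v + step j) (v + step j, ?w)) =
        complex_of_real (sqrt (?P * (real_qint n (?d + 1) / real_qint n ?d)))"
      by (rule cell[OF _ _ j l False vs(1,2) w])
    have cell_k: "W (cyc (?w, v) (v, v + step k) (v + step k, ?w)) =
        complex_of_real (sqrt (?P * (real_qint n ?dk / real_qint n ?d)))"
    proof (cases "k = j")
      case True
      then show ?thesis
        using cell_j False by simp
    next
      case k_neq: False
      then have "k = l"
        using k by simp
      have w_eq: "?w = v + step l + step j"
        by (simp add: add.commute add.left_commute)
      \<comment> \<open>Swapping the two directions negates the gap, and both signs cancel in the ratio.\<close>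
      have "real_qint n (gap v l j + 1) / real_qint n (gap v l j) = real_qint n (?d - 1) / real_qint n ?d"
        using real_qint_uminus[of n "?d - 1"] by (simp add: gap_swap[of v l j] real_qint_uminus)
      then show ?thesis
        using cell[OF _ _ l j False[symmetric], of v] vs w False \<open>k = l\<close>
        by (simp add: w_eq)
    qed
    have P: "?P > 0"
      using real_phi_pos[OF n] vs(1) w by simp
    have s: "?s > 0"
      using n by (intro sin_gt_zero) (auto simp: field_simps)
    have "cell_weight (A_graph n) (phi q) W ((v, v + step k), (v + step k, ?w))
        ((v, v + step j), (v + step j, ?w)) =
      complex_of_real (inverse ?P * (sqrt (?P * (real_qint n (?d + 1) / real_qint n ?d)) *
        sqrt (?P * (real_qint n ?dk / real_qint n ?d))))"
      using False unfolding cell_weight_def tail_head prod.case fst_conv snd_conv edges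
      by (simp add: phi_root_of_unity[OF q] cell_j cell_k)
    also have "sqrt (?P * (real_qint n (?d + 1) / real_qint n ?d)) *
        sqrt (?P * (real_qint n ?dk / real_qint n ?d)) =
      sqrt (?P\<^sup>2 * (real_qint n (?d + 1) * real_qint n ?dk / (real_qint n ?d)\<^sup>2))"
      unfolding real_sqrt_mult[symmetric] by (simp add: power2_eq_square mult_ac)
    also have "\<dots> = ?P * (sqrt (real_qint n (?d + 1) * real_qint n ?dk) / \<bar>real_qint n ?d\<bar>)"
      using P by (simp only: real_sqrt_mult real_sqrt_divide real_sqrt_abs abs_of_pos)
    also have "inverse ?P * \<dots> = sqrt (real_qint n (?d + 1) * real_qint n ?dk) / \<bar>real_qint n ?d\<bar>"
      by (simp only: mult.assoc[symmetric, of "inverse ?P" ?P]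
          left_inverse[OF less_imp_neq[OF P, symmetric]] mult_1_left)
    also have "\<dots> = sqrt (?s\<^sup>2 * (real_qint n (?d + 1) * real_qint n ?dk)) / \<bar>?s * real_qint n ?d\<bar>"
      using s by (simp add: real_sqrt_mult abs_mult)
    also have "?s\<^sup>2 * (real_qint n (?d + 1) * real_qint n ?dk) =
        (?s * real_qint n (?d + 1)) * (?s * real_qint n ?dk)"
      by (simp add: power2_eq_square mult_ac)
    also have "sqrt ((?s * real_qint n (?d + 1)) * (?s * real_qint n ?dk)) / \<bar>?s * real_qint n ?d\<bar> =
        wenzl_weight n e v j l k"
    proof -
      note s_fun = s_fun_eq_real_qint[OF n e j l, where v = v]
      have "k \<in> {1, 2, 3}"
        using k j l by auto
      from s_fun(2)[OF _ _ this] s_fun(2)[OF _ _ j] s_fun(1) False show ?thesis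
        by (simp add: wenzl_weight_def)
    qed
    finally show ?thesis .
  qed
qed

end
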